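(* For $m\ge3$ and $n\geq 2$, the zero-free chromatic polynomial of $B^{uv}(m,n)=(B(m,n),\{uv\})$ satisfies \[\chi^b_{B^{uv}(m,n)}(\lambda)=(\lambda-1)\gamma_{m-1}\chi^b_{B^{uv}(m,n-1)}(\lambda)+(-1)^{m-2}\lambda(\lambda-2)\gamma_m^{n-1}\] and equals \[\lambda(\lambda-1)^{n-1}\gamma_{m-1}^{n-1}\gamma_{m+1}+(-1)^{m-2}\lambda(\lambda-2)\gamma_m\frac{(\lambda-1)^{n-1}\gamma_{m-1}^{n-1}-\gamma_m^{n-1}}{(\lambda-1)\gamma_{m-1}-\gamma_m},\] where $\gamma_j=\frac{(\lambda-1)^{j-1}-(-1)^{j-1}}{\lambda}$ for $j\ge2$.
   Context: The book graph $B(m,n)$ has vertices $\{u,v\}\cup\{u_j^i:1\le i\le n,1\le j\le m-2\}$ and consists of the $n$ cycles $uu_1^i\cdots u_{m-2}^ivu$ sharing the edge $uv$; $B^{uv}(m,n)$ is the signed graph on $B(m,n)$ whose only negative edge is $uv$. A zero-free coloring in $2k$ signed colors is a map $c:V\to\{-k,\ldots,-1,1,\ldots,k\}$, proper if $c(x)\ne\sigma(e)c(y)$ for every edge $e=xy$; the zero-free chromatic polynomial is the polynomial whose value at $\lambda=2k$ counts proper zero-free colorings. *)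

theory Defs
  imports "HOL-Library.FuncSet" "HOL-Computational_Algebra.Computational_Algebra"
begin

record 'v graph =
  verts :: "'v set"
  edges :: "'v set set"

text \<open>A signed graph is a graph together with its set of negative edges.\<close>

type_synonym 'v signed_graph = "'v graph \<times> 'v set set"

definition edge_sign :: "'v signed_graph \<Rightarrow> 'v set \<Rightarrow> int" where
  "edge_sign S e = (if e \<in> snd S then - 1 else 1)"

definition zero_free_colors :: "nat \<Rightarrow> int set" where
  "zero_free_colors k = {- int k..int k} - {0}"

text \<open>Colorings are extensional functions, so that each map on the vertex set is counted once.\<close>

definition proper_zero_free_colorings :: "'v signed_graph \<Rightarrow> nat \<Rightarrow> ('v \<Rightarrow> int) set" where
  "proper_zero_free_colorings S k =
     {c \<in> verts (fst S) \<rightarrow>\<^sub>E zero_free_colors k.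
        \<forall>x y. {x, y} \<in> edges (fst S) \<longrightarrow> c x \<noteq> edge_sign S {x, y} * c y}"

definition zero_free_chromatic_poly :: "'v signed_graph \<Rightarrow> int poly" where
  "zero_free_chromatic_poly S =
     (THE p. \<forall>k. poly p (2 * int k) = int (card (proper_zero_free_colorings S k)))"

lemma zero_free_chromatic_poly_eqI:
  assumes "\<And>k. poly p (2 * int k) = int (card (proper_zero_free_colorings S k))"
  shows "zero_free_chromatic_poly S = p"
  unfolding zero_free_chromatic_poly_def
proof (rule the_equality)
  show "\<forall>k. poly p (2 * int k) = int (card (proper_zero_free_colorings S k))"
    using assms by blast
next
  fix q assume q: "\<forall>k. poly q (2 * int k) = int (card (proper_zero_free_colorings S k))"
  have sub: "range (\<lambda>k. 2 * int k) \<subseteq> {x. poly (q - p) x = 0}"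
    using q assms by auto
  have "infinite (range (\<lambda>k. 2 * int k))"
    by (rule range_inj_infinite) (simp add: inj_def)
  then have "infinite {x. poly (q - p) x = 0}"
    using sub infinite_super by blast
  then have "q - p = 0"
    using poly_roots_finite by blast
  then show "q = p" by simp
qed

text \<open>\<open>Page i j\<close> is the vertex $u_j^i$.\<close>

datatype book_vertex = U | V | Page nat nat

definition page_cycle :: "nat \<Rightarrow> nat \<Rightarrow> book_vertex list" where
  "page_cycle m i = U # map (Page i) [1..<m - 1] @ [V]"

definition cycle_edges :: "'v list \<Rightarrow> 'v set set" where
  "cycle_edges w = {{w ! j, w ! (Suc j mod length w)} | j. j < length w}"

definition book_graph :: "nat \<Rightarrow> nat \<Rightarrow> book_vertex graph" where
  "book_graph m n =
     \<lparr> verts = {U, V} \<union> {Page i j | i j. 1 \<le> i \<and> i \<le> n \<and> 1 \<le> j \<and> j \<le> m - 2},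
       edges = (\<Union>i\<in>{1..n}. cycle_edges (page_cycle m i)) \<rparr>"

definition book_uv :: "nat \<Rightarrow> nat \<Rightarrow> book_vertex signed_graph" where
  "book_uv m n = (book_graph m n, {{U, V}})"

text \<open>The identities involve quotients of polynomials in the variable $\lambda$. They are stated
  in the field of fractions of \<open>int poly\<close>, where the division is exact: all denominators that occur
  ($\lambda$, and $(\lambda-1)\gamma_{m-1}-\gamma_m = (-1)^{m-1}$) are nonzero there.\<close>

definition lam :: "int poly fract" where
  "lam = to_fract [:0, 1:]"

definition gam :: "nat \<Rightarrow> int poly fract" where
  "gam j = ((lam - 1) ^ (j - 1) - (- 1) ^ (j - 1)) / lam"

definition chi_b :: "'v signed_graph \<Rightarrow> int poly fract" where
  "chi_b S = to_fract (zero_free_chromatic_poly S)"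

end

theory Submission
  imports Defs
begin

text \<open>Fix the colors \<open>a\<close> of \<open>U\<close> and \<open>b\<close> of \<open>V\<close>. The pages are then colored independently, and a
  coloring of one page is a walk with \<open>m - 1\<close> steps from \<open>a\<close> to \<open>b\<close> in the complete graph on the
  \<open>\<lambda>\<close> colors: there are $A = (\lambda-1)\gamma_{m-1}$ of them if $a = b$ and $G = \gamma_m$
  otherwise. The negative edge forbids $a = -b$, so
  $\chi^b = \lambda A^n + \lambda(\lambda-2) G^n$. Both identities follow from this,
  $G - A = (-1)^{m-2}$ and $\gamma_{m+1} = A + (\lambda-2) G$.\<close>

section \<open>Walk polynomials and their link to gamma\<close>

text \<open>This is \<open>gam (Suc l)\<close> as an integer polynomial. The recursion has
  characteristic roots lambda - 1 and -1; defining gamma this way avoids division, so it can be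
  evaluated at numbers of colors, including 0.\<close>

fun walk_poly :: "nat \<Rightarrow> int poly" where
  "walk_poly 0 = 0"
| "walk_poly (Suc 0) = 1"
| "walk_poly (Suc (Suc l)) = [:- 1, 1:] * walk_poly l + [:- 2, 1:] * walk_poly (Suc l)"

text \<open>With P = lambda - 1, the recurrence reads t^2 = (P - 1) t + P, solved by t = P and t =
  -1. Both sides thus obey the same recurrence and agree for \<open>l\<close> = 0 and
  \<open>l\<close> = 1.\<close>

lemma pCons_mult_walk_poly: "[:0, 1:] * walk_poly l = [:- 1, 1:] ^ l - (- 1) ^ l"
proof (induction l rule: walk_poly.induct)
  case (3 l)
  define P :: "int poly" where "P = [:- 1, 1:]"
  define X :: "int poly" where "X = [:0, 1:]"
  have X: "X = P + 1" and Q: "[:- 2, 1:] = P - 1"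
    by (simp_all add: X_def P_def one_pCons)
  have "X * walk_poly (Suc (Suc l)) = P * (X * walk_poly l) + (P - 1) * (X * walk_poly (Suc l))"
    by (simp add: Q P_def[symmetric] algebra_simps)
  also have "\<dots> = P ^ Suc (Suc l) - (- 1) ^ Suc (Suc l)"
    unfolding 3[folded X_def P_def] by (simp add: algebra_simps)
  finally show ?case by (simp add: X_def P_def)
qed (simp_all add: one_pCons)

lemma to_fract_power: "to_fract (p ^ n) = to_fract p ^ n"
  by (induction n) auto

lemma lam_nonzero: "lam \<noteq> 0"
  by (simp add: lam_def)

lemma to_fract_lam_diff:
  "to_fract [:- 1, 1:] = lam - 1" "to_fract [:- 2, 1:] = lam - 2"
proof -
  have "[:- 1, 1:] = [:0, 1:] - (1 :: int poly)" "[:- 2, 1:] = [:0, 1:] - (1 + 1 :: int poly)"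
    by (simp_all add: one_pCons)
  then show "to_fract [:- 1, 1:] = lam - 1" "to_fract [:- 2, 1:] = lam - 2"
    by (simp_all only: lam_def to_fract_diff to_fract_add to_fract_1)
qed

lemma to_fract_walk_poly: "to_fract (walk_poly l) = gam (Suc l)"
proof -
  have "lam * to_fract (walk_poly l) = to_fract ([:- 1, 1:] ^ l - (- 1) ^ l)"
    by (simp only: lam_def flip: pCons_mult_walk_poly to_fract_mult)
  also have "\<dots> = (lam - 1) ^ l - (- 1) ^ l"
    by (simp add: to_fract_power to_fract_lam_diff)
  finally show ?thesis
    by (simp add: gam_def lam_nonzero field_simps)
qed

section \<open>Counting walks between two colors\<close>

text \<open>Only the \<open>l\<close> interior colors are listed, so the walk has
  \<open>l + 1\<close> steps; these are the colors of \<open>l\<close> page vertices between fixed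
  end colors.\<close>

definition walks :: "'a set \<Rightarrow> 'a \<Rightarrow> 'a \<Rightarrow> nat \<Rightarrow> 'a list set" where
  "walks C a b l = {xs. length xs = l \<and> set xs \<subseteq> C \<and> distinct_adj (a # xs @ [b])}"

lemma walks_0: "walks C a b 0 = (if a = b then {} else {[]})"
  by (auto simp: walks_def)

lemma walks_Suc: "walks C a b (Suc l) = (\<Union>x\<in>C - {a}. (#) x ` walks C x b l)"
  by (auto simp: walks_def length_Suc_conv)

lemma finite_walks: "finite C \<Longrightarrow> finite (walks C a b l)"
  by (rule finite_subset[OF _ finite_lists_length_eq[of C l]]) (auto simp: walks_def)

text \<open>Induction on the first interior color x, with the start \<open>a\<close> arbitrary. If
  \<open>a = b\<close>, every admissible x differs from \<open>b\<close>. Otherwise x =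
  \<open>b\<close> occurs once and the other q - 2 choices differ from \<open>b\<close>, which is
  the recurrence of \<open>walk_poly\<close>.\<close>

lemma card_walks:
  assumes "finite C" "a \<in> C" "b \<in> C"
  shows "int (card (walks C a b l)) =
    (if a = b then (int (card C) - 1) * poly (walk_poly l) (int (card C))
     else poly (walk_poly (Suc l)) (int (card C)))"
  using assms(2)
proof (induction l arbitrary: a)
  case 0
  then show ?case by (simp add: walks_0)
next
  case (Suc l)
  let ?q = "int (card C)"
  let ?w = "\<lambda>l. poly (walk_poly l) ?q"
  have "int (card (walks C a b (Suc l))) = (\<Sum>x\<in>C - {a}. int (card ((#) x ` walks C x b l)))"
    unfolding walks_Suc
    by (subst card_UN_disjoint) (use assms(1) in \<open>auto simp: finite_walks\<close>)
  also have "\<dots> = (\<Sum>x\<in>C - {a}. if x = b then (?q - 1) * ?w l else ?w (Suc l))"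
    by (rule sum.cong) (simp_all add: card_image Suc.IH)
  also have "\<dots> = (if a = b then (?q - 1) * ?w (Suc l) else ?w (Suc (Suc l)))"
  proof (cases "a = b")
    case True
    then have "(\<Sum>x\<in>C - {a}. if x = b then (?q - 1) * ?w l else ?w (Suc l)) =
        (\<Sum>x\<in>C - {a}. ?w (Suc l))"
      by (intro sum.cong) auto
    moreover have "int (card (C - {a})) = ?q - 1"
      using Suc.prems assms(1) card_gt_0_iff[of C] by (auto simp: of_nat_diff card_Diff_singleton)
    ultimately show ?thesis
      using True by simp
  next
    case False
    then have sub: "{a, b} \<subseteq> C" and "card {a, b} = 2"
      using Suc.prems assms(3) by auto
    \<comment> \<open>This bound keeps the natural-number subtraction from truncating when two
      colors are removed.\<close>
    then have "2 \<le> card C"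
      using card_mono[OF assms(1) sub] by simp
    then have card: "int (card (C - {a} - {b})) = ?q - 2"
      using sub assms(1) False
      by (simp add: of_nat_diff card_Diff_singleton)
    have "(\<Sum>x\<in>C - {a}. if x = b then (?q - 1) * ?w l else ?w (Suc l)) =
        (?q - 1) * ?w l + (\<Sum>x\<in>C - {a} - {b}. if x = b then (?q - 1) * ?w l else ?w (Suc l))"
      by (subst sum.remove[of _ b]) (use False assms in auto)
    also have "\<dots> = (?q - 1) * ?w l + (\<Sum>x\<in>C - {a} - {b}. ?w (Suc l))"
      by simp
    also have "\<dots> = (?q - 1) * ?w l + (?q - 2) * ?w (Suc l)"
      by (simp only: sum_constant card)
    finally show ?thesis
      using False by (simp add: algebra_simps)
  qed
  finally show ?case .
qed

section \<open>Properness along one page\<close>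

text \<open>A sign is its own inverse. The symmetry is needed because an unordered edge may match a
  consecutive pair of the cycle in either orientation.\<close>

lemma proper_edge_sym:
  "c x \<noteq> edge_sign S {x, y} * c y \<longleftrightarrow> c y \<noteq> edge_sign S {y, x} * c x"
  by (auto simp: edge_sign_def insert_commute)

lemma proper_cycle_edges_iff:
  "(\<forall>x y. {x, y} \<in> cycle_edges w \<longrightarrow> c x \<noteq> edge_sign S {x, y} * c y) \<longleftrightarrow>
   (\<forall>j<length w. c (w ! j) \<noteq> edge_sign S {w ! j, w ! (Suc j mod length w)}
      * c (w ! (Suc j mod length w)))"
  (is "?L \<longleftrightarrow> (\<forall>j<_. ?P (w ! j) (w ! (Suc j mod length w)))")
proof
  show "?L \<Longrightarrow> \<forall>j<length w. ?P (w ! j) (w ! (Suc j mod length w))"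
    unfolding cycle_edges_def by blast
next
  assume R: "\<forall>j<length w. ?P (w ! j) (w ! (Suc j mod length w))"
  show ?L
  proof (intro allI impI)
    fix x y assume "{x, y} \<in> cycle_edges w"
    then obtain j where "j < length w" "{x, y} = {w ! j, w ! (Suc j mod length w)}"
      unfolding cycle_edges_def by blast
    with R show "?P x y"
      using proper_edge_sym[of c x S y] by (metis doubleton_eq_iff)
  qed
qed

lemma length_page_cycle: "m \<ge> 3 \<Longrightarrow> length (page_cycle m i) = m"
  by (simp add: page_cycle_def)

lemma page_cycle_nth:
  assumes "m \<ge> 3" "j < m"
  shows "page_cycle m i ! j = (if j = 0 then U else if j = m - 1 then V else Page i j)"
  using assms by (auto simp: page_cycle_def nth_append nth_Cons split: nat.splits)

lemma distinct_adj_conv_nth: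
  "distinct_adj xs \<longleftrightarrow> (\<forall>j<length xs - 1. xs ! j \<noteq> xs ! Suc j)"
proof (induction xs rule: induct_list012)
  case (3 x y zs)
  then show ?case
    by (auto simp: less_Suc_eq_0_disj)
qed simp_all

text \<open>The edge that closes the cycle is the negative edge and yields
  \<open>c U \<noteq> - c V\<close>; all others are positive and ask that consecutive colors differ
  along the path from \<open>U\<close> to \<open>V\<close>.\<close>

lemma proper_page_iff:
  assumes "m \<ge> 3"
  shows "(\<forall>x y. {x, y} \<in> cycle_edges (page_cycle m i) \<longrightarrow>
            c x \<noteq> edge_sign (book_uv m n) {x, y} * c y) \<longleftrightarrow>
         c U \<noteq> - c V \<and> distinct_adj (c U # map (\<lambda>j. c (Page i j)) [1..<m - 1] @ [c V])"
proof -
  let ?w = "page_cycle m i"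
  let ?P = "\<lambda>j. c (?w ! j) \<noteq> edge_sign (book_uv m n) {?w ! j, ?w ! (Suc j mod m)}
      * c (?w ! (Suc j mod m))"
  have len: "length ?w = m"
    using assms by (rule length_page_cycle)
  \<comment> \<open>At index \<open>m - 1\<close> the successor wraps around to 0, giving the edge
    from \<open>V\<close> back to \<open>U\<close>.\<close>
  have closing: "?P (m - 1) \<longleftrightarrow> c U \<noteq> - c V"
    using assms by (auto simp: page_cycle_nth edge_sign_def book_uv_def insert_commute)
  have step: "?P j \<longleftrightarrow> c (?w ! j) \<noteq> c (?w ! Suc j)" if "j < m - 1" for j
  proof -
    \<comment> \<open>Since \<open>m \<ge> 3\<close>, at least one page vertex separates
      \<open>U\<close> from \<open>V\<close> on the path, so no path edge is the negative
      one.\<close>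
    have "{?w ! j, ?w ! Suc j} \<noteq> {U, V}"
      using that assms by (auto simp: page_cycle_nth doubleton_eq_iff)
    then show ?thesis
      using that by (simp add: edge_sign_def book_uv_def)
  qed
  have "{..<m} = insert (m - 1) {..<m - 1}"
    using assms by auto
  then have "(\<forall>j<m. ?P j) \<longleftrightarrow> ?P (m - 1) \<and> (\<forall>j<m - 1. ?P j)"
    by (metis (no_types, lifting) insert_iff lessThan_iff)
  also have "\<dots> \<longleftrightarrow> c U \<noteq> - c V \<and> (\<forall>j<m - 1. c (?w ! j) \<noteq> c (?w ! Suc j))"
    using closing step by auto
  also have "(\<forall>j<m - 1. c (?w ! j) \<noteq> c (?w ! Suc j)) \<longleftrightarrow> distinct_adj (map c ?w)"
    using assms by (auto simp: distinct_adj_conv_nth len)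
  also have "map c ?w = c U # map (\<lambda>j. c (Page i j)) [1..<m - 1] @ [c V]"
    by (simp add: page_cycle_def)
  finally show ?thesis
    unfolding proper_cycle_edges_iff len .
qed

section \<open>Counting the colorings of the whole book\<close>

lemma proper_zero_free_colorings_book_uv:
  assumes "m \<ge> 3" "n \<ge> 1"
  shows "proper_zero_free_colorings (book_uv m n) k =
    {c \<in> verts (book_graph m n) \<rightarrow>\<^sub>E zero_free_colors k. c U \<noteq> - c V \<and>
       (\<forall>i\<in>{1..n}. map (\<lambda>j. c (Page i j)) [1..<m - 1]
          \<in> walks (zero_free_colors k) (c U) (c V) (m - 2))}"
proof -
  have "(\<forall>x y. {x, y} \<in> edges (book_graph m n) \<longrightarrow>
            c x \<noteq> edge_sign (book_uv m n) {x, y} * c y) \<longleftrightarrow>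
        c U \<noteq> - c V \<and> (\<forall>i\<in>{1..n}. map (\<lambda>j. c (Page i j)) [1..<m - 1]
          \<in> walks (zero_free_colors k) (c U) (c V) (m - 2))"
    (is "?L \<longleftrightarrow> ?R") if c: "c \<in> verts (book_graph m n) \<rightarrow>\<^sub>E zero_free_colors k" for c
  proof -
    have colors: "set (map (\<lambda>j. c (Page i j)) [1..<m - 1]) \<subseteq> zero_free_colors k"
      if "i \<in> {1..n}" for i
      using c that by (fastforce simp: book_graph_def PiE_iff)
    have "?L \<longleftrightarrow> (\<forall>i\<in>{1..n}. \<forall>x y. {x, y} \<in> cycle_edges (page_cycle m i) \<longrightarrow>
            c x \<noteq> edge_sign (book_uv m n) {x, y} * c y)"
      by (auto simp: book_graph_def)
    also have "\<dots> \<longleftrightarrow> (\<forall>i\<in>{1..n}. c U \<noteq> - c V \<and>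
        distinct_adj (c U # map (\<lambda>j. c (Page i j)) [1..<m - 1] @ [c V]))"
      using assms(1) by (simp only: proper_page_iff)
    \<comment> \<open>The condition on \<open>U\<close> and \<open>V\<close> does not depend on the
      page; it leaves the quantifier because \<open>n \<ge> 1\<close> provides a page.\<close>
    also have "\<dots> \<longleftrightarrow> c U \<noteq> - c V \<and>
        (\<forall>i\<in>{1..n}. distinct_adj (c U # map (\<lambda>j. c (Page i j)) [1..<m - 1] @ [c V]))"
      using assms(2) by auto
    also have "\<dots> \<longleftrightarrow> ?R"
      using colors assms(1) by (auto simp: walks_def)
    finally show ?thesis .
  qed
  then show ?thesis
    unfolding proper_zero_free_colorings_def by (auto simp: book_uv_def)
qed

text \<open>A coloring is encoded by the colors of \<open>U\<close> and \<open>V\<close> and a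
  family of walks, one per page. The families form a product, hence the power
  \<open>n\<close>.\<close>

lemma card_proper_zero_free_colorings_book_uv:
  assumes "m \<ge> 3" "n \<ge> 1"
  shows "card (proper_zero_free_colorings (book_uv m n) k) =
    (\<Sum>a\<in>zero_free_colors k. \<Sum>b\<in>zero_free_colors k - {- a}.
       card (walks (zero_free_colors k) a b (m - 2)) ^ n)"
proof -
  let ?C = "zero_free_colors k"
  let ?W = "\<lambda>a b. walks ?C a b (m - 2)"
  let ?T = "SIGMA a:?C. SIGMA b:?C - {- a}. {1..n} \<rightarrow>\<^sub>E ?W a b"
  let ?page = "\<lambda>c i. map (\<lambda>j. c (Page i j)) [1..<m - 1]"
  define enc where "enc c = (c U, c V, \<lambda>i\<in>{1..n}. ?page c i)" for c :: "book_vertex \<Rightarrow> int"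
  \<comment> \<open>The restriction makes the decoded map extensional, as colorings are. The shift
    \<open>j - 1\<close> is due to page vertices being numbered from 1 and list entries from
    0.\<close>
  define dec where "dec = (\<lambda>(a, b, F). \<lambda>x\<in>verts (book_graph m n).
    case x of U \<Rightarrow> a | V \<Rightarrow> b | Page i j \<Rightarrow> (F i :: int list) ! (j - 1))"
  have fin: "finite ?C"
    by (simp add: zero_free_colors_def)
  have verts: "U \<in> verts (book_graph m n)" "V \<in> verts (book_graph m n)"
    "\<And>i j. Page i j \<in> verts (book_graph m n) \<longleftrightarrow> i \<in> {1..n} \<and> j \<in> {1..m - 2}"
    by (auto simp: book_graph_def)
  have dec_page: "?page (dec (a, b, F)) i = F i"
    if "i \<in> {1..n}" "F \<in> {1..n} \<rightarrow>\<^sub>E ?W a b" for a b F i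
  proof -
    have "length (F i) = m - 2"
      using that by (auto simp: walks_def PiE_iff)
    then show ?thesis
      using that(1) assms(1) by (intro nth_equalityI) (auto simp: dec_def verts)
  qed
  have "bij_betw enc (proper_zero_free_colorings (book_uv m n) k) ?T"
    unfolding proper_zero_free_colorings_book_uv[OF assms]
  proof (rule bij_betw_byWitness[where f' = dec])
    show "\<forall>c\<in>{c \<in> verts (book_graph m n) \<rightarrow>\<^sub>E ?C. c U \<noteq> - c V \<and>
        (\<forall>i\<in>{1..n}. ?page c i \<in> ?W (c U) (c V))}. dec (enc c) = c"
    proof clarify
      fix c assume c: "c \<in> verts (book_graph m n) \<rightarrow>\<^sub>E ?C"
      show "dec (enc c) = c"
      proof (rule extensionalityI[of _ "verts (book_graph m n)"])
        show "dec (enc c) \<in> extensional (verts (book_graph m n))"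
          by (simp add: dec_def enc_def)
        show "c \<in> extensional (verts (book_graph m n))"
          using c by (simp add: PiE_iff)
        show "dec (enc c) x = c x" if "x \<in> verts (book_graph m n)" for x
          using that by (cases x) (auto simp: dec_def enc_def verts)
      qed
    qed
    show "\<forall>t\<in>?T. enc (dec t) = t"
    proof
      fix t assume "t \<in> ?T"
      then obtain a b F where t: "t = (a, b, F)" and F: "F \<in> {1..n} \<rightarrow>\<^sub>E ?W a b"
        by (elim SigmaE) simp
      have "(\<lambda>i\<in>{1..n}. ?page (dec (a, b, F)) i) = F"
      proof (rule extensionalityI[of _ "{1..n}"])
        show "F \<in> extensional {1..n}"
          using F by (simp add: PiE_iff)
        show "(\<lambda>i\<in>{1..n}. ?page (dec (a, b, F)) i) i = F i" if "i \<in> {1..n}" for i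
          using that dec_page[OF that F] by simp
      qed simp
      then show "enc (dec t) = t"
        unfolding t enc_def by (simp add: dec_def verts)
    qed
    show "enc ` {c \<in> verts (book_graph m n) \<rightarrow>\<^sub>E ?C. c U \<noteq> - c V \<and>
        (\<forall>i\<in>{1..n}. ?page c i \<in> ?W (c U) (c V))} \<subseteq> ?T"
      using verts by (auto simp: enc_def PiE_iff)
    show "dec ` ?T \<subseteq> {c \<in> verts (book_graph m n) \<rightarrow>\<^sub>E ?C. c U \<noteq> - c V \<and>
        (\<forall>i\<in>{1..n}. ?page c i \<in> ?W (c U) (c V))}"
    proof (rule image_subsetI)
      fix s assume "s \<in> ?T"
      then obtain a b F where s: "s = (a, b, F)"
        and t: "a \<in> ?C" "b \<in> ?C" "b \<noteq> - a" "F \<in> {1..n} \<rightarrow>\<^sub>E ?W a b"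
        by (elim SigmaE) simp
      have UV: "dec (a, b, F) U = a" "dec (a, b, F) V = b"
        by (simp_all add: dec_def verts)
      have "F i ! (j - 1) \<in> ?C" if "i \<in> {1..n}" "j \<in> {1..m - 2}" for i j
      proof -
        have "F i \<in> ?W a b"
          using t(4) that(1) by blast
        then have "set (F i) \<subseteq> ?C" "j - 1 < length (F i)"
          using that(2) by (auto simp: walks_def)
        then show ?thesis
          using nth_mem by blast
      qed
      then have "dec (a, b, F) \<in> verts (book_graph m n) \<rightarrow>\<^sub>E ?C"
        using t by (auto simp: dec_def verts split: book_vertex.split)
      moreover have "?page (dec (a, b, F)) i \<in> ?W a b" if "i \<in> {1..n}" for i
        using t(4) that dec_page[OF that t(4)] by (auto simp del: map_eq_conv)
      ultimately show "dec s \<in> {c \<in> verts (book_graph m n) \<rightarrow>\<^sub>E ?C. c U \<noteq> - c V \<and>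
          (\<forall>i\<in>{1..n}. ?page c i \<in> ?W (c U) (c V))}"
        using t(3) unfolding s mem_Collect_eq UV by (metis minus_minus)
    qed
  qed
  then have "card (proper_zero_free_colorings (book_uv m n) k) = card ?T"
    by (rule bij_betw_same_card)
  also have "\<dots> = (\<Sum>a\<in>?C. \<Sum>b\<in>?C - {- a}. card ({1..n} \<rightarrow>\<^sub>E ?W a b))"
    using fin by (simp add: finite_PiE finite_walks)
  also have "\<dots> = (\<Sum>a\<in>?C. \<Sum>b\<in>?C - {- a}. card (?W a b) ^ n)"
    by (simp add: card_PiE)
  finally show ?thesis .
qed

lemma zero_free_chromatic_poly_book_uv:
  assumes "m \<ge> 3" "n \<ge> 1"
  shows "zero_free_chromatic_poly (book_uv m n) =
    [:0, 1:] * ([:- 1, 1:] * walk_poly (m - 2)) ^ n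
    + [:0, 1:] * [:- 2, 1:] * walk_poly (m - 1) ^ n"
proof (rule zero_free_chromatic_poly_eqI)
  fix k
  let ?C = "zero_free_colors k"
  let ?q = "2 * int k"
  let ?A = "(?q - 1) * poly (walk_poly (m - 2)) ?q"
  let ?G = "poly (walk_poly (m - 1)) ?q"
  have fin: "finite ?C"
    by (simp add: zero_free_colors_def)
  have card: "int (card ?C) = ?q"
    by (simp add: zero_free_colors_def card_Diff_singleton)
  have "Suc (m - 2) = m - 1"
    using assms(1) by simp
  then have walks: "int (card (walks ?C a b (m - 2))) = (if a = b then ?A else ?G)"
    if "a \<in> ?C" "b \<in> ?C" for a b
    using card_walks[OF fin that, of "m - 2"] by (simp add: card)
  have inner: "(\<Sum>b\<in>?C - {- a}. int (card (walks ?C a b (m - 2))) ^ n) = ?A ^ n + (?q - 2) * ?G ^ n"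
    if a: "a \<in> ?C" for a
  proof -
    \<comment> \<open>As 0 is not a color, \<open>a\<close> differs from \<open>- a\<close>, so
      \<open>b = a\<close> is always allowed and contributes one term with equal ends.\<close>
    have mem: "- a \<in> ?C" "a \<noteq> - a"
      using a by (auto simp: zero_free_colors_def)
    \<comment> \<open>There are thus at least two colors, so removing \<open>a\<close> and
      \<open>- a\<close> leaves q - 2 without truncation.\<close>
    have "card {a, - a} \<le> card ?C"
      using a mem by (intro card_mono fin) auto
    then have c: "int (card (?C - {- a} - {a})) = ?q - 2"
      using a mem card fin by (simp add: card_Diff_singleton of_nat_diff)
    have "(\<Sum>b\<in>?C - {- a}. int (card (walks ?C a b (m - 2))) ^ n) =
        (\<Sum>b\<in>?C - {- a}. if b = a then ?A ^ n else ?G ^ n)"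
      using a by (intro sum.cong) (auto simp: walks)
    also have "\<dots> = ?A ^ n + (\<Sum>b\<in>?C - {- a} - {a}. if b = a then ?A ^ n else ?G ^ n)"
      by (subst sum.remove[of _ a]) (use a mem fin in auto)
    also have "\<dots> = ?A ^ n + (\<Sum>b\<in>?C - {- a} - {a}. ?G ^ n)"
      by simp
    also have "\<dots> = ?A ^ n + (?q - 2) * ?G ^ n"
      by (simp only: sum_constant c)
    finally show ?thesis .
  qed
  have "int (card (proper_zero_free_colorings (book_uv m n) k)) =
      (\<Sum>a\<in>?C. \<Sum>b\<in>?C - {- a}. int (card (walks ?C a b (m - 2))) ^ n)"
    by (simp add: card_proper_zero_free_colorings_book_uv[OF assms])
  also have "\<dots> = (\<Sum>a\<in>?C. ?A ^ n + (?q - 2) * ?G ^ n)"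
    by (rule sum.cong) (simp_all add: inner)
  also have "\<dots> = ?q * (?A ^ n + (?q - 2) * ?G ^ n)"
    by (simp only: sum_constant card)
  also have "\<dots> = poly ([:0, 1:] * ([:- 1, 1:] * walk_poly (m - 2)) ^ n
      + [:0, 1:] * [:- 2, 1:] * walk_poly (m - 1) ^ n) ?q"
    by (simp add: algebra_simps)
  finally show "poly ([:0, 1:] * ([:- 1, 1:] * walk_poly (m - 2)) ^ n
      + [:0, 1:] * [:- 2, 1:] * walk_poly (m - 1) ^ n) ?q =
      int (card (proper_zero_free_colorings (book_uv m n) k))" ..
qed

section \<open>The chromatic polynomial in terms of gamma and the two identities\<close>

lemma chi_b_book_uv:
  assumes "m \<ge> 3" "n \<ge> 1"
  shows "chi_b (book_uv m n) =
    lam * ((lam - 1) * gam (m - 1)) ^ n + lam * (lam - 2) * gam m ^ n"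
proof -
  have "Suc (m - 2) = m - 1" "Suc (m - 1) = m"
    using assms(1) by simp_all
  then show ?thesis
    unfolding chi_b_def zero_free_chromatic_poly_book_uv[OF assms]
    by (simp only: to_fract_add to_fract_mult to_fract_power to_fract_lam_diff to_fract_walk_poly
        flip: lam_def)
qed

text \<open>Multiplied by lambda, the top powers of lambda - 1 cancel and what remains is (-1)^(m-2)
  (1 + (lambda - 1)). This also shows that the denominator in the closed form is nonzero.\<close>

lemma gam_diff:
  assumes "m \<ge> 2"
  shows "gam m - (lam - 1) * gam (m - 1) = (- 1) ^ (m - 2)"
proof -
  obtain l where "m = Suc (Suc l)"
    using assms by (metis add_2_eq_Suc le_Suc_ex)
  then show ?thesis
    using lam_nonzero by (simp add: gam_def field_simps)
qed

text \<open>This is the recurrence of \<open>walk_poly\<close> in terms of gamma; it expands the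
  factor \<open>gam (m + 1)\<close> of the closed form.\<close>

lemma gam_Suc:
  assumes "m \<ge> 2"
  shows "gam (m + 1) = (lam - 1) * gam (m - 1) + (lam - 2) * gam m"
proof -
  obtain l where "m = Suc (Suc l)"
    using assms by (metis add_2_eq_Suc le_Suc_ex)
  then show ?thesis
    using lam_nonzero by (simp add: gam_def field_simps)
qed

theorem theorem4p6:
  fixes m n :: nat
  assumes "m \<ge> 3" and "n \<ge> 2"
  shows "chi_b (book_uv m n) =
           (lam - 1) * gam (m - 1) * chi_b (book_uv m (n - 1))
           + (- 1) ^ (m - 2) * lam * (lam - 2) * gam m ^ (n - 1)
       \<and> chi_b (book_uv m n) =
           lam * (lam - 1) ^ (n - 1) * gam (m - 1) ^ (n - 1) * gam (m + 1)
           + (- 1) ^ (m - 2) * lam * (lam - 2) * gam m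
             * (((lam - 1) ^ (n - 1) * gam (m - 1) ^ (n - 1) - gam m ^ (n - 1))
                / ((lam - 1) * gam (m - 1) - gam m))"
proof -
  \<comment> \<open>Having \<open>r \<ge> 1\<close> lets the formula for \<open>chi_b\<close> apply
    to the book with one page fewer.\<close>
  obtain r where n: "n = Suc r" and "r \<ge> 1"
    using assms(2) by (cases n) auto
  define A where "A = (lam - 1) * gam (m - 1)"
  define G where "G = gam m"
  define s :: "int poly fract" where "s = (- 1) ^ (m - 2)"
  have chi: "chi_b (book_uv m n) = lam * A ^ Suc r + lam * (lam - 2) * G ^ Suc r"
    "chi_b (book_uv m r) = lam * A ^ r + lam * (lam - 2) * G ^ r"
    using assms(1) \<open>r \<ge> 1\<close> by (simp_all only: chi_b_book_uv n A_def G_def)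
  have s: "s = G - A"
    using gam_diff[of m] assms(1) by (simp add: s_def G_def A_def)
  have g: "gam (m + 1) = A + (lam - 2) * G"
    using gam_Suc[of m] assms(1) by (simp add: G_def A_def)
  have "s \<noteq> 0"
    by (simp add: s_def)
  \<comment> \<open>Since s = G - A is nonzero, s / (A - G) = -1, so the sign in the closed form
    cancels its denominator.\<close>
  then have quotient: "s * (x / (A - G)) = - x" for x
    by (simp add: s field_simps)
  \<comment> \<open>Replacing s by G - A turns A G^r into G^(r+1) in the second summand, while A A^r
    is already right.\<close>
  have "chi_b (book_uv m n) = A * chi_b (book_uv m r) + s * lam * (lam - 2) * G ^ r"
    unfolding chi s by (simp add: algebra_simps)
  moreover have "chi_b (book_uv m n) = lam * A ^ r * gam (m + 1)
      + lam * (lam - 2) * G * (s * ((A ^ r - G ^ r) / (A - G)))"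
    unfolding chi g quotient by (simp add: algebra_simps)
  ultimately show ?thesis
    unfolding n A_def G_def s_def by (simp add: power_mult_distrib mult_ac)
qed

end
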